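(* Let $V=\mathbb R^n$ and let $W$ be a self-annihilating linear subspace of the exterior algebra $\bigwedge V$. Then $\dim W\le 2^{n-1}$. Furthermore, if $W\subseteq\bigwedge^r V$, where $r\le n/2$, then $$\dim W\le\binom{n-1}{r-1}.$$
   Context: $\bigwedge V=\bigoplus_{r=0}^n\bigwedge^r V$ is the exterior algebra of $V$ with its standard grading. A linear subspace $W\subseteq\bigwedge V$ is self-annihilating if $v\wedge w=0$ for all $v,w\in W$ (including $v=w$). *)

theory Defs
  imports "HOL-Analysis.Analysis"
begin

text \<open>
  The exterior algebra of \<open>V = real ^ 'n\<close> is realised on \<open>real ^ 'n set\<close>: the coordinate of \<open>x\<close> at
  \<open>S = {i1 < \<dots> < ik}\<close> is the coefficient of \<open>e_i1 \<and> \<dots> \<and> e_ik\<close>. The order on \<open>'n\<close> serves only to fix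
  the signs of these monomials. That this is the exterior algebra is checked below: \<open>wedge\<close> is
  bilinear, associative and unital, \<open>v \<and> v = 0\<close> for \<open>v\<close> in \<open>V\<close>, and it has the universal property
  (theorem \<open>exterior_universal\<close>).
\<close>

type_synonym 'n exterior = "real ^ 'n set"

text \<open>The sign of the permutation sorting the concatenation of sorted \<open>S\<close> and sorted \<open>T\<close>.\<close>

definition wedge_sign :: "'n::linorder set \<Rightarrow> 'n set \<Rightarrow> real" where
  "wedge_sign S T = (- 1) ^ card {(i, j). i \<in> S \<and> j \<in> T \<and> j < i}"

definition wedge :: "'n::{finite,linorder} exterior \<Rightarrow> 'n exterior \<Rightarrow> 'n exterior" where
  "wedge x y = (\<chi> U. \<Sum>S\<in>Pow U. wedge_sign S (U - S) * x $ S * y $ (U - S))"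

definition ext_one :: "'n::{finite,linorder} exterior" where
  "ext_one = axis {} 1"

definition ext_incl :: "real ^ 'n::{finite,linorder} \<Rightarrow> 'n::{finite,linorder} exterior" where
  "ext_incl v = (\<Sum>i\<in>UNIV. (v $ i) *\<^sub>R axis {i} 1)"

definition wedge_list :: "(real ^ 'n::{finite,linorder}) list \<Rightarrow> 'n::{finite,linorder} exterior" where
  "wedge_list vs = foldr (\<lambda>v. wedge (ext_incl v)) vs ext_one"

definition ext_power :: "nat \<Rightarrow> 'n::{finite,linorder} exterior set" where
  "ext_power r = span {wedge_list vs |vs. length vs = r}"

definition self_annihilating :: "'n::{finite,linorder} exterior set \<Rightarrow> bool" where
  "self_annihilating W \<longleftrightarrow> (\<forall>v\<in>W. \<forall>w\<in>W. wedge v w = 0)"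


lemma exterior_expansion: "(\<Sum>S\<in>UNIV. (x $ S) *\<^sub>R axis S 1) = (x :: 'n::finite exterior)"
  using basis_expansion[of x] by (simp add: scalar_mult_eq_scaleR)

lemma exterior_linear_eq:
  fixes f g :: "'n::finite exterior \<Rightarrow> 'b::real_vector"
  assumes "linear f" "linear g" "\<And>S. f (axis S 1) = g (axis S 1)"
  shows "f x = g x"
proof -
  have "f (\<Sum>S\<in>UNIV. (x $ S) *\<^sub>R axis S 1) = g (\<Sum>S\<in>UNIV. (x $ S) *\<^sub>R axis S 1)"
    using assms by (simp add: linear_sum linear_scale)
  then show ?thesis by (simp only: exterior_expansion)
qed

lemma linear_wedge_left: "linear (\<lambda>x. wedge x y)"
  by (rule linearI)
    (simp_all add: wedge_def vec_eq_iff algebra_simps sum.distrib sum_distrib_left)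

lemma linear_wedge_right: "linear (wedge x)"
  by (rule linearI)
    (simp_all add: wedge_def vec_eq_iff algebra_simps sum.distrib sum_distrib_left)

lemma bilinear_wedge: "bilinear wedge"
  by (simp add: bilinear_def linear_wedge_left linear_wedge_right)

lemma wedge_zero [simp]: "wedge 0 x = 0" "wedge x 0 = 0"
  using bilinear_lzero[OF bilinear_wedge] bilinear_rzero[OF bilinear_wedge] by auto

lemma wedge_scaleR [simp]: "wedge (c *\<^sub>R x) y = c *\<^sub>R wedge x y" "wedge x (c *\<^sub>R y) = c *\<^sub>R wedge x y"
  by (simp_all add: linear_scale[OF linear_wedge_left] linear_scale[OF linear_wedge_right])

lemma wedge_axis:
  "wedge (axis S 1) (axis T 1) = (if S \<inter> T = {} then wedge_sign S T *\<^sub>R axis (S \<union> T) 1 else 0)"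
proof (rule vec_eq_iff[THEN iffD2, rule_format])
  fix U :: "'a set"
  have iff: "S \<subseteq> U \<and> U - S = T \<longleftrightarrow> S \<inter> T = {} \<and> U = S \<union> T" by blast
  have "wedge (axis S 1) (axis T 1) $ U =
      (\<Sum>X\<in>Pow U. if X = S then (if U - S = T then wedge_sign S T else 0) else 0)"
    unfolding wedge_def vec_lambda_beta by (rule sum.cong) (auto simp: axis_def)
  also have "\<dots> = (if S \<subseteq> U \<and> U - S = T then wedge_sign S T else 0)"
    by simp
  also have "\<dots> = (if S \<inter> T = {} then wedge_sign S T *\<^sub>R axis (S \<union> T) 1 else 0) $ U"
    unfolding iff by (auto simp: axis_def)
  finally show "wedge (axis S 1) (axis T 1) $ U = \<dots>" .
qed

lemma wedge_sign_empty [simp]: "wedge_sign {} T = 1" "wedge_sign S {} = 1"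
  by (simp_all add: wedge_sign_def)

lemma wedge_sign_Un_left:
  fixes S :: "'n::{finite,linorder} set"
  assumes "S \<inter> T = {}"
  shows "wedge_sign (S \<union> T) R = wedge_sign S R * wedge_sign T R"
proof -
  have "{(i, j). i \<in> S \<union> T \<and> j \<in> R \<and> j < i} =
      {(i, j). i \<in> S \<and> j \<in> R \<and> j < i} \<union> {(i, j). i \<in> T \<and> j \<in> R \<and> j < i}" by auto
  moreover have "card \<dots> =
      card {(i, j). i \<in> S \<and> j \<in> R \<and> j < i} + card {(i, j). i \<in> T \<and> j \<in> R \<and> j < i}"
    using assms by (intro card_Un_disjoint) auto
  ultimately show ?thesis by (simp add: wedge_sign_def power_add)
qed

lemma wedge_sign_Un_right:
  fixes S :: "'n::{finite,linorder} set"
  assumes "T \<inter> R = {}"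
  shows "wedge_sign S (T \<union> R) = wedge_sign S T * wedge_sign S R"
proof -
  have "{(i, j). i \<in> S \<and> j \<in> T \<union> R \<and> j < i} =
      {(i, j). i \<in> S \<and> j \<in> T \<and> j < i} \<union> {(i, j). i \<in> S \<and> j \<in> R \<and> j < i}" by auto
  moreover have "card \<dots> =
      card {(i, j). i \<in> S \<and> j \<in> T \<and> j < i} + card {(i, j). i \<in> S \<and> j \<in> R \<and> j < i}"
    using assms by (intro card_Un_disjoint) auto
  ultimately show ?thesis by (simp add: wedge_sign_def power_add)
qed

lemma wedge_sign_below: "\<forall>j\<in>T. i < j \<Longrightarrow> wedge_sign {i} T = 1"
proof -
  assume "\<forall>j\<in>T. i < j"
  then have "{(i', j). i' \<in> {i} \<and> j \<in> T \<and> j < i'} = {}" by auto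
  then show ?thesis unfolding wedge_sign_def by (simp only: card.empty power_0)
qed

lemma wedge_sign_single:
  "wedge_sign {i} {j} = (if j < i then - 1 else 1)"
proof -
  have "{(i', j'). i' \<in> {i} \<and> j' \<in> {j} \<and> j' < i'} = (if j < i then {(i, j)} else {})" by auto
  then show ?thesis by (simp add: wedge_sign_def)
qed

lemma wedge_one [simp]: "wedge ext_one x = x" "wedge x ext_one = x"
proof -
  show "wedge ext_one x = x"
    by (rule exterior_linear_eq[where f = "wedge ext_one" and g = "\<lambda>x. x"])
      (auto simp: linear_wedge_right ext_one_def wedge_axis linear_id[unfolded id_def])
  show "wedge x ext_one = x"
    by (rule exterior_linear_eq[where f = "\<lambda>x. wedge x ext_one" and g = "\<lambda>x. x"])
      (auto simp: linear_wedge_left ext_one_def wedge_axis linear_id[unfolded id_def])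
qed

lemma wedge_assoc: "wedge (wedge x y) z = wedge x (wedge y z)"
proof -
  note ll = linear_compose[unfolded o_def]
  have 1: "wedge (wedge (axis S 1) (axis T 1)) (axis R 1) =
      wedge (axis S 1) (wedge (axis T 1) (axis R 1))" for S T R :: "'a set"
    by (auto simp: wedge_axis wedge_sign_Un_left wedge_sign_Un_right Int_Un_distrib Int_Un_distrib2 Un_assoc)
  have 2: "wedge (wedge (axis S 1) (axis T 1)) z = wedge (axis S 1) (wedge (axis T 1) z)" for S T :: "'a set"
    by (rule exterior_linear_eq[where x = z])
      (auto intro: 1 linear_wedge_right ll[OF linear_wedge_right linear_wedge_right])
  have 3: "wedge (wedge (axis S 1) y) z = wedge (axis S 1) (wedge y z)" for S :: "'a set"
    by (rule exterior_linear_eq[where x = y])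
      (auto intro: 2 ll[OF linear_wedge_right linear_wedge_left] ll[OF linear_wedge_left linear_wedge_right])
  show ?thesis
    by (rule exterior_linear_eq[where x = x])
      (auto intro: 3 linear_wedge_left ll[OF linear_wedge_left linear_wedge_left])
qed

lemma linear_ext_incl: "linear ext_incl"
  by (rule linearI) (simp_all add: ext_incl_def algebra_simps sum.distrib scaleR_sum_right)

lemma ext_incl_nth: "ext_incl v $ S = (if \<exists>i. S = {i} then v $ (THE i. S = {i}) else 0)"
proof (cases "\<exists>i. S = {i}")
  case True
  then obtain i where i: "S = {i}" by blast
  have "ext_incl v $ S = (\<Sum>j\<in>UNIV. if j = i then v $ i else 0)"
    unfolding ext_incl_def sum_component i by (rule sum.cong) (auto simp: axis_def)
  then show ?thesis using i by simp
next
  case False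
  then show ?thesis by (auto simp: ext_incl_def axis_def intro!: sum.neutral)
qed

lemma inj_ext_incl: "inj ext_incl"
proof (rule injI)
  fix v w :: "(real, 'a) vec" assume "ext_incl v = ext_incl w"
  then have "ext_incl v $ {i} = ext_incl w $ {i}" for i by simp
  then show "v = w" by (simp add: ext_incl_nth vec_eq_iff)
qed

lemma ext_incl_axis [simp]: "ext_incl (axis i 1) = axis {i} 1"
proof -
  have "ext_incl (axis i 1) = (\<Sum>j\<in>UNIV. if j = i then axis {i} 1 else 0)"
    unfolding ext_incl_def by (rule sum.cong) (auto simp: axis_def)
  then show ?thesis by simp
qed

lemma wedge_gen_commute: "wedge (axis {i} 1) (axis {j} 1) = - wedge (axis {j} 1) (axis {i} 1)"
  by (auto simp: wedge_axis wedge_sign_single insert_commute)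

lemma wedge_ext_incl_commute: "wedge (ext_incl v) (ext_incl w) = - wedge (ext_incl w) (ext_incl v)"
proof -
  have expand: "wedge (ext_incl v) (ext_incl w) =
      (\<Sum>i\<in>UNIV. \<Sum>j\<in>UNIV. (v $ i * w $ j) *\<^sub>R wedge (axis {i} 1) (axis {j} 1))" for v w :: "(real, 'a) vec"
    unfolding ext_incl_def
    by (simp add: linear_sum[OF linear_wedge_left] linear_sum[OF linear_wedge_right] scaleR_sum_right)
      (subst sum.swap, simp add: mult.commute)
  have "wedge (ext_incl v) (ext_incl w) =
      (\<Sum>j\<in>UNIV. \<Sum>i\<in>UNIV. (v $ i * w $ j) *\<^sub>R wedge (axis {i} 1) (axis {j} 1))"
    unfolding expand by (rule sum.swap)
  also have "\<dots> = (\<Sum>j\<in>UNIV. \<Sum>i\<in>UNIV. - ((w $ j * v $ i) *\<^sub>R wedge (axis {j} 1) (axis {i} 1)))"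
    by (intro sum.cong refl) (subst wedge_gen_commute, simp add: mult.commute)
  also have "\<dots> = - wedge (ext_incl w) (ext_incl v)"
    unfolding expand by (simp add: sum_negf)
  finally show ?thesis .
qed

theorem wedge_ext_incl_self: "wedge (ext_incl v) (ext_incl v) = 0"
proof -
  have "wedge (ext_incl v) (ext_incl v) + wedge (ext_incl v) (ext_incl v) = 0"
    using wedge_ext_incl_commute[of v v] by (simp only: eq_neg_iff_add_eq_0)
  then have "2 *\<^sub>R wedge (ext_incl v) (ext_incl v) = 0" by (simp only: scaleR_2)
  then show ?thesis by simp
qed

lemma axis_insert_below:
  assumes "\<forall>j\<in>S. i < j"
  shows "axis (insert i S) 1 = wedge (axis {i} 1) (axis S 1)"
  using assms by (auto simp: wedge_axis wedge_sign_below)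

lemma sorted_list_insert_below:
  fixes A :: "'n::{finite,linorder} set"
  assumes "\<forall>a\<in>A. b < a"
  shows "sorted_list_of_set (insert b A) = b # sorted_list_of_set A"
proof -
  have "b \<notin> A" using assms by auto
  then have "sorted_list_of_set (insert b A) = insort b (sorted_list_of_set A)"
    by (simp add: sorted_list_of_set_insert)
  also have "\<dots> = b # sorted_list_of_set A"
    by (rule insort_is_Cons) (use assms in auto)
  finally show ?thesis .
qed

lemma axis_eq_wedge_list:
  "axis S 1 = wedge_list (map (\<lambda>i. axis i 1) (sorted_list_of_set S))"
proof (induction S rule: finite_linorder_min_induct[OF finite])
  case 1
  then show ?case by (simp add: wedge_list_def ext_one_def)
next
  case (2 b A)
  have "sorted_list_of_set (insert b A) = b # sorted_list_of_set A"
    by (rule sorted_list_insert_below) (use 2 in auto)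
  moreover have "axis (insert b A) 1 = wedge (axis {b} (1::real)) (axis A 1)"
    by (rule axis_insert_below) (use 2 in auto)
  ultimately show ?case using 2(3) by (simp add: wedge_list_def)
qed


lemma ext_power_iff: "x \<in> ext_power r \<longleftrightarrow> (\<forall>S. x $ S \<noteq> 0 \<longrightarrow> card S = r)"
proof
  have step: "card U = Suc k"
    if x: "\<And>S. x $ S \<noteq> 0 \<Longrightarrow> card S = k" and U: "wedge (ext_incl v) x $ U \<noteq> 0" for v x k and U :: "'a set"
  proof -
    from U obtain S where S: "S \<subseteq> U" "ext_incl v $ S \<noteq> 0" "x $ (U - S) \<noteq> 0"
      unfolding wedge_def by (auto elim!: sum.not_neutral_contains_not_neutral)
    then obtain i where "S = {i}" by (auto simp: ext_incl_nth split: if_splits)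
    with S x[of "U - S"] show ?thesis by (metis card_Suc_Diff1 finite insert_subset)
  qed
  have wl: "card S = length vs" if "wedge_list vs $ S \<noteq> 0" for vs and S :: "'a set"
    using that
  proof (induction vs arbitrary: S)
    case Nil
    then show ?case by (auto simp: wedge_list_def ext_one_def axis_def split: if_splits)
  next
    case (Cons v vs)
    have "wedge_list (v # vs) = wedge (ext_incl v) (wedge_list vs)" by (simp add: wedge_list_def)
    with step[of "wedge_list vs" "length vs" v S] Cons show ?case by simp
  qed
  have sub: "subspace {x :: 'a exterior. \<forall>S. x $ S \<noteq> 0 \<longrightarrow> card S = r}"
    by (auto simp: subspace_def) (metis add.right_neutral)
  assume "x \<in> ext_power r"
  then have "x \<in> span {x. \<forall>S. x $ S \<noteq> 0 \<longrightarrow> card S = r}"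
    unfolding ext_power_def by (rule subsetD[OF span_mono, rotated]) (use wl in auto)
  then show "\<forall>S. x $ S \<noteq> 0 \<longrightarrow> card S = r"
    using span_eq_iff[THEN iffD2, OF sub] by auto
next
  assume x: "\<forall>S. x $ S \<noteq> 0 \<longrightarrow> card S = r"
  have "(x $ S) *\<^sub>R axis S 1 \<in> ext_power r" for S
  proof (cases "x $ S = 0")
    case False
    with x have "length (map (\<lambda>i. axis i (1::real)) (sorted_list_of_set S)) = r" by simp
    then show ?thesis
      unfolding ext_power_def axis_eq_wedge_list by (intro span_scale span_base) blast
  qed (simp add: ext_power_def span_zero)
  then have "(\<Sum>S\<in>UNIV. (x $ S) *\<^sub>R axis S 1) \<in> ext_power r"
    unfolding ext_power_def by (intro span_sum)
  then show "x \<in> ext_power r" by (simp only: exterior_expansion)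
qed

lemma monomial_hom:
  fixes g :: "'n::{finite,linorder} \<Rightarrow> 'b::real_algebra_1"
  assumes sq: "\<And>i. g i * g i = 0" and anti: "\<And>i j. g i * g j = - (g j * g i)"
  defines "P \<equiv> \<lambda>S. prod_list (map g (sorted_list_of_set S))"
  shows "P S * P T = (if S \<inter> T = {} then wedge_sign S T *\<^sub>R P (S \<union> T) else 0)"
proof -
  have P0: "P {} = 1" by (simp add: P_def)
  have ins: "P (insert b A) = g b * P A" if "\<forall>a\<in>A. b < a" for b A
  proof -
    have "sorted_list_of_set (insert b A) = b # sorted_list_of_set A"
      by (rule sorted_list_insert_below) (use that in auto)
    then show ?thesis by (simp add: P_def)
  qed
  have g: "g i * P T = (if i \<in> T then 0 else wedge_sign {i} T *\<^sub>R P (insert i T))" for i T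
  proof (induction T rule: finite_linorder_min_induct[OF finite])
    case 1
    then show ?case using ins[of "{}" i] by (simp add: P0)
  next
    case (2 b A)
    consider "i < b" | "i = b" | "b < i" by fastforce
    then show ?case
    proof cases
      case 1
      with 2 have lt: "\<forall>a\<in>insert b A. i < a" by auto
      then show ?thesis using ins[OF lt] wedge_sign_below[OF lt] by auto
    next
      case 2
      have "g i * P (insert b A) = (g b * g b) * P A"
        using "2" ins[OF \<open>\<forall>x\<in>A. b < x\<close>] by (simp add: mult.assoc)
      then show ?thesis using 2 by (simp add: sq)
    next
      case 3
      have bA: "b \<notin> A" using 2 by auto
      have "g i * P (insert b A) = (g i * g b) * P A"
        using ins[OF \<open>\<forall>x\<in>A. b < x\<close>] by (simp add: mult.assoc)
      also have "\<dots> = - (g b * (g i * P A))"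
        by (subst anti) (simp add: mult.assoc)
      also have "\<dots> = (if i \<in> A then 0 else (- wedge_sign {i} A) *\<^sub>R (g b * P (insert i A)))"
        using 2 by auto
      also have "g b * P (insert i A) = P (insert b (insert i A))"
        using ins[of "insert i A" b] 2 3 by auto
      also have "- wedge_sign {i} A = wedge_sign {i} (insert b A)"
        using wedge_sign_Un_right[of "{b}" A "{i}"] bA 3 by (simp add: wedge_sign_single)
      finally show ?thesis using 3 by (auto simp: insert_commute)
    qed
  qed
  show ?thesis
  proof (induction S rule: finite_linorder_min_induct[OF finite])
    case 1
    then show ?case by (simp add: P0)
  next
    case (2 b A)
    have bA: "b \<notin> A" using 2 by auto
    have "P (insert b A) * P T = g b * (P A * P T)"
      using ins[of A b] 2 by (simp add: mult.assoc)
    also have "\<dots> = (if A \<inter> T = {} then wedge_sign A T *\<^sub>R (g b * P (A \<union> T)) else 0)"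
      using 2 by simp
    also have "\<dots> = (if insert b A \<inter> T = {} then wedge_sign (insert b A) T *\<^sub>R P (insert b A \<union> T) else 0)"
      using bA wedge_sign_Un_left[of "{b}" A T] wedge_sign_Un_right[of A T "{b}"]
        wedge_sign_below[of A b] 2 by (auto simp: g)
    finally show ?case .
  qed
qed

theorem exterior_universal:
  fixes f :: "real ^ 'n::{finite,linorder} \<Rightarrow> 'b::real_algebra_1"
  assumes f: "linear f" and sq: "\<And>v. f v * f v = 0"
  shows "\<exists>!F. linear F \<and> F ext_one = 1 \<and> (\<forall>x y. F (wedge x y) = F x * F y) \<and> (\<forall>v. F (ext_incl v) = f v)"
proof -
  define g where "g i = f (axis i 1)" for i
  define P where "P S = prod_list (map g (sorted_list_of_set S))" for S
  define F where "F x = (\<Sum>S\<in>UNIV. (x $ S) *\<^sub>R P S)" for x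
  have anti: "f v * f w = - (f w * f v)" for v w
    using sq[of "v + w"] sq[of v] sq[of w]
    by (simp add: linear_add[OF f] algebra_simps eq_neg_iff_add_eq_0)
  have linF: "linear F"
    by (rule linearI) (simp_all add: F_def algebra_simps sum.distrib scaleR_sum_right)
  have Fax: "F (axis S 1) = P S" for S
  proof -
    have "F (axis S 1) = (\<Sum>T\<in>UNIV. if T = S then P S else 0)"
      unfolding F_def by (rule sum.cong) (auto simp: axis_def)
    then show ?thesis by simp
  qed
  have PP: "P S * P T = (if S \<inter> T = {} then wedge_sign S T *\<^sub>R P (S \<union> T) else 0)" for S T
    using monomial_hom[of g S T] sq anti unfolding P_def g_def by blast
  note ll = linear_compose[unfolded o_def]
  have lm: "linear (\<lambda>x. F x * c)" "linear (\<lambda>x. c * F x)" for c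
    using linF by (auto simp: linear_iff algebra_simps)
  have 1: "F (wedge (axis S 1) (axis T 1)) = F (axis S 1) * F (axis T 1)" for S T
    by (auto simp: wedge_axis Fax PP linear_scale[OF linF] linear_0[OF linF])
  have 2: "F (wedge (axis S 1) y) = F (axis S 1) * F y" for S y
    by (rule exterior_linear_eq[where x = y]) (auto intro: 1 lm ll[OF linear_wedge_right linF])
  have 3: "F (wedge x y) = F x * F y" for x y
    by (rule exterior_linear_eq[where x = x]) (auto intro: 2 lm ll[OF linear_wedge_left linF])
  have 4: "F (ext_incl v) = f v" for v
  proof -
    have "F (ext_incl v) = (\<Sum>i\<in>UNIV. (v $ i) *\<^sub>R f (axis i 1))"
      by (simp add: ext_incl_def linear_sum[OF linF] linear_scale[OF linF] Fax P_def g_def)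
    also have "\<dots> = f (\<Sum>i\<in>UNIV. (v $ i) *s axis i 1)"
      by (simp add: linear_sum[OF f] linear_scale[OF f] scalar_mult_eq_scaleR)
    finally show ?thesis by (simp only: basis_expansion)
  qed
  have 5: "F ext_one = 1" by (simp add: ext_one_def Fax P_def)
  show ?thesis
  proof (rule ex1I[of _ F])
    fix G
    assume G: "linear G \<and> G ext_one = 1 \<and> (\<forall>x y. G (wedge x y) = G x * G y) \<and> (\<forall>v. G (ext_incl v) = f v)"
    have eq: "G (wedge_list vs) = F (wedge_list vs)" for vs
      by (induction vs) (use G 3 4 5 in \<open>simp_all add: wedge_list_def\<close>)
    show "G = F"
      by (rule ext, rule exterior_linear_eq)
        (use G linF in \<open>simp_all add: axis_eq_wedge_list eq\<close>)
  qed (use linF 3 4 5 in blast)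
qed

end

theory Submission
  imports Defs "HOL-Combinatorics.Permutations" "HOL-Library.Nat_Bijection"
begin

text \<open>
  Order the subsets of the index set by the binary number of which they are the digit sets. The
  weight of a disjoint union is the sum of the weights, so this is a monomial order: if \<open>S\<close> and
  \<open>T\<close> are the heaviest sets in the supports of \<open>v\<close> and \<open>w\<close>, and \<open>S\<close> and \<open>T\<close> are disjoint, then the
  coefficient of \<open>v \<and> w\<close> at \<open>S \<union> T\<close> is, up to sign, the product of the two leading coefficients,
  because no other pair can reach the total weight. Hence the leading sets of a self-annihilating
  subspace \<open>W\<close> form an intersecting family (\<open>pairwise_intersecting_leading_indices\<close>). As \<open>W\<close> has at
  least as many leading sets as its dimension (\<open>dim_le_card_leading_indices\<close>), both bounds become
  bounds on intersecting families of subsets of an \<open>n\<close>-element set.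

  For the first bound, an intersecting family contains at most one of any two complementary sets.
  For the second, all leading sets of elements of the \<open>r\<close>-th exterior power have \<open>r\<close> elements, and
  the Erdos-Ko-Rado theorem applies. It is proved by Katona's cycle method: among the \<open>n\<close> arcs of
  length \<open>r\<close> on a cycle, at most \<open>r\<close> can pairwise intersect, and every \<open>r\<close>-set is an arc equally
  often when the cycle runs through all permutations of the \<open>n\<close> elements. The family therefore
  contains at most the fraction \<open>r / n\<close> of all \<open>r\<close>-sets.
\<close>

section \<open>Leading sets\<close>

definition leading_indices :: "('i \<Rightarrow> nat) \<Rightarrow> (real ^ 'i::finite) set \<Rightarrow> 'i set" where
  "leading_indices f W = {s. \<exists>v\<in>W. v $ s \<noteq> 0 \<and> (\<forall>t. v $ t \<noteq> 0 \<longrightarrow> f t \<le> f s)}"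

text \<open>
  A nonzero vector of \<open>W\<close> has a nonzero coordinate at one of its heaviest support indices, which is
  a leading index, so the projection to the coordinates in the leading indices is injective on \<open>W\<close>.
\<close>

lemma dim_le_card_leading_indices:
  fixes W :: "(real ^ 'i::finite) set"
  assumes W: "subspace W"
  shows "dim W \<le> card (leading_indices f W)"
proof -
  let ?L = "leading_indices f W"
  define p where "p v = (\<chi> s. if s \<in> ?L then v $ s else 0)" for v :: "real ^ 'i"
  have lin: "linear p"
    by (rule linearI) (auto simp: p_def vec_eq_iff)
  have "v = 0" if v: "v \<in> W" "p v = 0" for v
  proof (rule ccontr)
    assume "v \<noteq> 0"
    then have ne: "{s. v $ s \<noteq> 0} \<noteq> {}" by (auto simp: vec_eq_iff)
    then have "Max (f ` {s. v $ s \<noteq> 0}) \<in> f ` {s. v $ s \<noteq> 0}" by (intro Max_in) auto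
    then obtain s where s: "v $ s \<noteq> 0" "f s = Max (f ` {s. v $ s \<noteq> 0})" by auto
    then have "\<forall>t. v $ t \<noteq> 0 \<longrightarrow> f t \<le> f s" by auto
    with s v have "s \<in> ?L" by (auto simp: leading_indices_def)
    then have "p v $ s = v $ s" by (simp add: p_def)
    with s v show False by simp
  qed
  then have "inj_on p (span W)"
    using W by (simp add: linear_injective_on_subspace_0[OF lin W] span_eq_iff[THEN iffD2, OF W])
  then have "dim W = dim (p ` W)"
    using dim_image_eq[OF lin] by metis
  moreover have "p ` W \<subseteq> span ((\<lambda>s. axis s 1) ` ?L)"
  proof
    fix y assume "y \<in> p ` W"
    then have y: "y $ s = 0" if "s \<notin> ?L" for s using that by (auto simp: p_def)
    have "y = (\<Sum>s\<in>UNIV. (y $ s) *\<^sub>R axis s 1)"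
      using basis_expansion[of y] by (simp add: scalar_mult_eq_scaleR)
    also have "\<dots> = (\<Sum>s\<in>?L. (y $ s) *\<^sub>R axis s 1)"
      by (rule sum.mono_neutral_right) (auto simp: y)
    also have "\<dots> \<in> span ((\<lambda>s. axis s 1) ` ?L)"
      by (intro span_sum span_scale span_base imageI)
    finally show "y \<in> span ((\<lambda>s. axis s 1) ` ?L)" .
  qed
  then have "dim (p ` W) \<le> card ((\<lambda>s. axis s (1::real)) ` ?L)"
    by (intro dim_le_card) auto
  moreover have "card ((\<lambda>s. axis s (1::real)) ` ?L) \<le> card ?L" by (rule card_image_le) simp
  ultimately show ?thesis by linarith
qed

text \<open>
  The code of \<open>S\<close> is the sum of \<open>2 ^ i\<close> over the numbers \<open>i\<close> of its elements. Any numbering of the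
  elements gives a weight that is both injective and additive on disjoint unions; these two
  properties make it a monomial order.
\<close>

definition set_weight :: "'n::finite set \<Rightarrow> nat" where
  "set_weight S = set_encode (to_nat ` S)"

lemma set_weight_eq_iff: "set_weight S = set_weight T \<longleftrightarrow> S = T"
  by (simp add: set_weight_def set_encode_eq inj_image_eq_iff)

lemma set_weight_Un:
  assumes "S \<inter> T = {}"
  shows "set_weight (S \<union> T) = set_weight S + set_weight T"
  unfolding set_weight_def image_Un set_encode_def
  by (rule sum.union_disjoint) (use assms in \<open>auto dest: injD[OF inj_to_nat]\<close>)

text \<open>
  The two sets may coincide, so a member of such a family is nonempty. For leading sets this
  case reflects \<open>v \<and> v = 0\<close>.
\<close>

definition pairwise_intersecting :: "'a set set \<Rightarrow> bool" where
  "pairwise_intersecting F \<longleftrightarrow> (\<forall>A\<in>F. \<forall>B\<in>F. A \<inter> B \<noteq> {})"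

text \<open>
  If \<open>S\<close> and \<open>T\<close> were disjoint leading sets of \<open>v\<close> and \<open>w\<close>, the coefficient of \<open>v \<and> w\<close> at \<open>S \<union> T\<close>
  would have a single nonzero term: a pair of sets that splits \<open>S \<union> T\<close> has the same total weight
  as \<open>S\<close> and \<open>T\<close>, and if it contributes, its members are at most as heavy as \<open>S\<close> and \<open>T\<close>. So both
  weights agree, and the pair is \<open>(S, T)\<close>.
\<close>

lemma pairwise_intersecting_leading_indices:
  fixes W :: "'n::{finite,linorder} exterior set"
  assumes W: "self_annihilating W"
  shows "pairwise_intersecting (leading_indices set_weight W)"
  unfolding pairwise_intersecting_def
proof (intro ballI notI)
  fix S T
  assume "S \<in> leading_indices set_weight W" "T \<in> leading_indices set_weight W" and ST: "S \<inter> T = {}"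
  then obtain v w where v: "v \<in> W" "v $ S \<noteq> 0" "\<And>A. v $ A \<noteq> 0 \<Longrightarrow> set_weight A \<le> set_weight S"
    and w: "w \<in> W" "w $ T \<noteq> 0" "\<And>A. w $ A \<noteq> 0 \<Longrightarrow> set_weight A \<le> set_weight T"
    by (auto simp: leading_indices_def)
  let ?U = "S \<union> T"
  let ?c = "\<lambda>A. wedge_sign A (?U - A) * v $ A * w $ (?U - A)"
  have UT: "?U - S = T" using ST by auto
  have only: "A = S" if "A \<in> Pow ?U" "?c A \<noteq> 0" for A
  proof -
    have "set_weight A + set_weight (?U - A) = set_weight ?U"
      using set_weight_Un[of A "?U - A"] that by (simp add: Un_absorb1)
    moreover have "set_weight S + set_weight T = set_weight ?U"
      using set_weight_Un[OF ST] by simp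
    moreover have "set_weight A \<le> set_weight S" "set_weight (?U - A) \<le> set_weight T"
      using v(3)[of A] w(3)[of "?U - A"] that by auto
    ultimately have "set_weight A = set_weight S" by linarith
    then show ?thesis by (simp add: set_weight_eq_iff)
  qed
  have "wedge v w $ ?U = (\<Sum>A\<in>Pow ?U. ?c A)" by (simp add: wedge_def)
  also have "\<dots> = (\<Sum>A\<in>{S}. ?c A)"
    by (rule sum.mono_neutral_right) (use only in auto)
  also have "\<dots> = wedge_sign S T * v $ S * w $ T" by (simp add: UT)
  finally have "wedge v w $ ?U \<noteq> 0" using v w by (simp add: wedge_sign_def)
  moreover have "wedge v w = 0" using W v w by (simp add: self_annihilating_def)
  ultimately show False by simp
qed

section \<open>Intersecting families\<close>

text \<open>A set and its complement cannot both belong to the family, so the family and the family of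
  complements are disjoint.\<close>

lemma card_pairwise_intersecting_le:
  fixes F :: "'n::finite set set"
  assumes "pairwise_intersecting F"
  shows "card F \<le> 2 ^ (CARD('n) - 1)"
proof -
  have "F \<inter> uminus ` F = {}"
    using assms by (fastforce simp: pairwise_intersecting_def)
  then have "card F + card (uminus ` F) = card (F \<union> uminus ` F)"
    by (simp add: card_Un_disjoint)
  also have "\<dots> \<le> card (UNIV :: 'n set set)" by (intro card_mono) auto
  also have "\<dots> = 2 ^ CARD('n)" by (simp add: card_UNIV_set)
  also have "\<dots> = 2 * 2 ^ (CARD('n) - 1)"
    by (simp flip: power_Suc)
  finally show ?thesis by (simp add: card_image inj_on_def)
qed

definition cyclic_arc :: "nat \<Rightarrow> nat \<Rightarrow> int \<Rightarrow> int set" where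
  "cyclic_arc n r i = (\<lambda>k. (i + int k) mod int n) ` {..<r}"

lemma cyclic_arc_subset: "0 < n \<Longrightarrow> cyclic_arc n r i \<subseteq> {0..<int n}"
  by (auto simp: cyclic_arc_def)

lemma card_cyclic_arc:
  assumes "r \<le> n"
  shows "card (cyclic_arc n r i) = r"
proof -
  have "inj_on (\<lambda>k. (i + int k) mod int n) {..<r}"
  proof (rule inj_onI)
    fix k l assume kl: "k \<in> {..<r}" "l \<in> {..<r}" "(i + int k) mod int n = (i + int l) mod int n"
    then have "int n dvd int k - int l"
      by (simp add: mod_eq_dvd_iff)
    then have "int k mod int n = int l mod int n" by (simp add: mod_eq_dvd_iff)
    with kl assms show "k = l" by simp
  qed
  then show ?thesis by (simp add: cyclic_arc_def card_image)
qed

text \<open>Two arcs of length \<open>r\<close> meet only if their starting points are less than \<open>r\<close> apart, in one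
  direction or the other around the cycle.\<close>

lemma cyclic_arcs_meet:
  assumes "cyclic_arc n r i \<inter> cyclic_arc n r j \<noteq> {}" "r \<le> n"
  shows "(j - i) mod int n < int r \<or> int n - int r < (j - i) mod int n"
proof -
  obtain k l where kl: "k < r" "l < r" "(i + int k) mod int n = (j + int l) mod int n"
    using assms by (auto simp: cyclic_arc_def)
  then have "int n dvd (i + int k) - (j + int l)" by (simp add: mod_eq_dvd_iff)
  then have "int n dvd (j - i) - (int k - int l)"
    by (subst dvd_minus_iff[symmetric]) (simp add: algebra_simps)
  then have eq: "(j - i) mod int n = (int k - int l) mod int n" by (simp add: mod_eq_dvd_iff)
  show ?thesis
  proof (cases "l \<le> k")
    case True
    then have "(int k - int l) mod int n = int k - int l"
      using kl assms by (intro mod_pos_pos_trivial) auto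
    with eq kl show ?thesis by linarith
  next
    case False
    have "(int k - int l) mod int n = (int k - int l + int n) mod int n" by simp
    also have "\<dots> = int k - int l + int n"
      using False kl assms by (intro mod_pos_pos_trivial) auto
    finally show ?thesis using eq kl by linarith
  qed
qed

text \<open>
  Fix one arc of the family, starting at \<open>i\<close>. Any other arc of the family starts at a
  distance \<open>d\<close> clockwise from \<open>i\<close> with \<open>0 < d < r\<close> or \<open>n - r < d < n\<close>. The arcs at distances \<open>d\<close> and
  \<open>d + (n - r)\<close> are disjoint because \<open>2 * r \<le> n\<close>, so each such pair of distances contributes at most
  one arc. The map \<open>\<phi>\<close> below sends both members of a pair to \<open>d\<close>.
\<close>

lemma card_intersecting_arcs_le:
  assumes I: "I \<subseteq> {0..<int n}" and r: "2 * r \<le> n"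
    and meet: "\<And>i j. i \<in> I \<Longrightarrow> j \<in> I \<Longrightarrow> cyclic_arc n r i \<inter> cyclic_arc n r j \<noteq> {}"
  shows "card I \<le> r"
proof (cases "I = {}")
  case False
  then obtain i where i: "i \<in> I" by auto
  with I have n: "0 < int n" by auto
  define d where "d j = (j - i) mod int n" for j
  define \<phi> where "\<phi> j = (if d j < int r then d j else d j - (int n - int r))" for j
  have d: "0 \<le> d j" "d j < int n" for j using n by (auto simp: d_def)
  have dI: "d j < int r \<or> int n - int r < d j" if "j \<in> I" for j
    using cyclic_arcs_meet[OF meet[OF i that]] r by (simp add: d_def)
  have far: False if "j \<in> I" "k \<in> I" "d k = d j + (int n - int r)" for j k
  proof -
    have "(k - j) mod int n = (d k - d j) mod int n" by (simp add: d_def mod_diff_eq)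
    also have "\<dots> = int n - int r"
    proof -
      have "0 < r" using meet[OF that(1) that(1)] by (auto simp: cyclic_arc_def)
      then have "(int n - int r) mod int n = int n - int r"
        using r by (intro mod_pos_pos_trivial) auto
      then show ?thesis using that by (simp only: add_diff_cancel_left')
    qed
    finally show False using cyclic_arcs_meet[OF meet[OF that(1,2)]] r by auto
  qed
  have inj: "inj_on \<phi> I"
  proof (rule inj_onI)
    fix j k assume jk: "j \<in> I" "k \<in> I" "\<phi> j = \<phi> k"
    have "d j = d k"
      using jk far[of j k] far[of k j] by (auto simp: \<phi>_def split: if_splits)
    then have "(d j + i) mod int n = (d k + i) mod int n" by simp
    then have "j mod int n = k mod int n" by (simp add: d_def mod_add_left_eq)
    with jk I show "j = k" by (auto simp: subset_iff)
  qed
  have "\<phi> ` I \<subseteq> {0..<int r}"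
    using d dI by (fastforce simp: \<phi>_def)
  then have "card (\<phi> ` I) \<le> card {0..<int r}" by (intro card_mono) auto
  with inj show ?thesis by (simp add: card_image)
qed auto

lemma exists_permutation_image_eq:
  assumes X: "finite X" and B: "B \<subseteq> X" "C \<subseteq> X" "card B = card C"
  obtains \<sigma> where "\<sigma> permutes X" "\<sigma> ` B = C"
proof -
  have fin: "finite B" "finite C" using B X finite_subset by auto
  obtain f where f: "bij_betw f B C"
    using finite_same_card_bij[OF fin B(3)] by auto
  have "card (X - B) = card (X - C)" using B fin by (simp add: card_Diff_subset)
  then obtain g where g: "bij_betw g (X - B) (X - C)"
    using finite_same_card_bij[of "X - B" "X - C"] X by auto
  define \<sigma> where "\<sigma> x = (if x \<in> B then f x else if x \<in> X then g x else x)" for x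
  have sf: "bij_betw \<sigma> B C" using f by (subst bij_betw_cong[of _ _ f]) (auto simp: \<sigma>_def)
  have sg: "bij_betw \<sigma> (X - B) (X - C)"
    using g by (subst bij_betw_cong[of _ _ g]) (auto simp: \<sigma>_def)
  have "bij_betw \<sigma> (B \<union> (X - B)) (C \<union> (X - C))"
    by (rule bij_betw_combine[OF sf sg]) auto
  then have "bij_betw \<sigma> X X" using B by (simp add: Un_absorb1)
  then have "\<sigma> permutes X" by (rule bij_imp_permutes) (use B in \<open>auto simp: \<sigma>_def\<close>)
  moreover have "\<sigma> ` B = C" using sf by (simp add: bij_betw_def)
  ultimately show ?thesis by (rule that)
qed

text \<open>
  Composition with a permutation that takes \<open>C\<close> to \<open>D\<close> turns the permutations taking \<open>A\<close> to \<open>C\<close> into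
  ones taking \<open>A\<close> to \<open>D\<close>. Each possible image of \<open>A\<close> is therefore attained equally often.
\<close>

lemma card_permutations_image_eq:
  assumes X: "finite X" and A: "A \<subseteq> X" and B: "B \<subseteq> X" "card B = card A"
  shows "card {\<pi>. \<pi> permutes X \<and> \<pi> ` A = B} * (card X choose card A) = fact (card X)"
proof -
  let ?P = "{\<pi>. \<pi> permutes X}"
  let ?N = "\<lambda>C. {\<pi>. \<pi> permutes X \<and> \<pi> ` A = C}"
  let ?R = "{C. C \<subseteq> X \<and> card C = card A}"
  have finP: "finite ?P" using X by (rule finite_permutations)
  have le: "card (?N C) \<le> card (?N D)" if CD: "C \<in> ?R" "D \<in> ?R" for C D
  proof -
    obtain \<sigma> where s: "\<sigma> permutes X" "\<sigma> ` C = D"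
      using exists_permutation_image_eq[OF X, of C D] CD by auto
    show ?thesis
    proof (rule card_inj_on_le[where f = "\<lambda>\<pi>. \<sigma> \<circ> \<pi>"])
      show "inj_on (\<lambda>\<pi>. \<sigma> \<circ> \<pi>) (?N C)"
        by (rule inj_on_subset[OF fun.inj_map[OF permutes_inj[OF s(1)]]]) simp
      show "(\<lambda>\<pi>. \<sigma> \<circ> \<pi>) ` ?N C \<subseteq> ?N D"
        using s by (auto intro: permutes_compose simp: image_comp[symmetric])
      show "finite (?N D)" by (rule finite_subset[OF _ finP]) auto
    qed
  qed
  have "fact (card X) = card ?P" using card_permutations[OF refl X] by simp
  also have "?P = (\<Union>C\<in>?R. ?N C)"
  proof -
    have "\<pi> ` A \<in> ?R" if "\<pi> permutes X" for \<pi>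
      using that A permutes_image[OF that] card_image[OF inj_on_subset[OF permutes_inj[OF that]]] by auto
    then show ?thesis by auto
  qed
  also have "card \<dots> = (\<Sum>C\<in>?R. card (?N C))"
    by (rule card_UN_disjoint) (use X finite_subset[OF _ finP] in auto)
  also have "\<dots> = (\<Sum>C\<in>?R. card (?N B))"
  proof (rule sum.cong[OF refl])
    fix C assume "C \<in> ?R"
    moreover have "B \<in> ?R" using B by simp
    ultimately show "card (?N C) = card (?N B)" by (intro antisym le)
  qed
  also have "\<dots> = card (?N B) * (card X choose card A)"
    by (simp add: n_subsets[OF X])
  finally show ?thesis by simp
qed

text \<open>
  The proof counts in two ways the pairs of a permutation \<open>\<pi>\<close> of \<open>X\<close> and an arc whose image under
  \<open>\<pi>\<close> belongs to \<open>F\<close>. For a fixed \<open>\<pi>\<close> there are at most \<open>r\<close> such arcs, and for a fixed arc the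
  number of such \<open>\<pi>\<close> is proportional to the size of \<open>F\<close>.
\<close>

theorem erdos_ko_rado:
  assumes X: "finite X" and F: "pairwise_intersecting F" "\<And>A. A \<in> F \<Longrightarrow> A \<subseteq> X \<and> card A = r"
    and r: "0 < r" "2 * r \<le> card X"
  shows "card F \<le> (card X - 1) choose (r - 1)"
proof -
  define n where "n = card X"
  let ?P = "{\<pi>. \<pi> permutes X}"
  let ?Z = "{0..<int n}"
  have rn: "r \<le> n" "0 < n" using r by (auto simp: n_def)
  have finF: "finite F" by (rule finite_subset[of _ "Pow X"]) (use F X in auto)
  have finP: "finite ?P" using X by (rule finite_permutations)
  obtain h where h: "bij_betw h ?Z X"
    using finite_same_card_bij[of ?Z X] X by (auto simp: n_def)
  define a where "a i = h ` cyclic_arc n r i" for i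
  have a: "a i \<subseteq> X" "card (a i) = r" for i
  proof -
    have "inj_on h (cyclic_arc n r i)"
      using h cyclic_arc_subset[of n r i] rn by (auto simp: bij_betw_def intro: inj_on_subset)
    then show "card (a i) = r" by (simp add: a_def card_image card_cyclic_arc rn)
    show "a i \<subseteq> X" using h cyclic_arc_subset[of n r i] rn by (auto simp: a_def bij_betw_def)
  qed
  have arcs: "card {i\<in>?Z. \<pi> ` a i \<in> F} \<le> r" if p: "\<pi> permutes X" for \<pi>
  proof (rule card_intersecting_arcs_le[where n = n])
    fix i j assume "i \<in> {i\<in>?Z. \<pi> ` a i \<in> F}" "j \<in> {i\<in>?Z. \<pi> ` a i \<in> F}"
    then have "\<pi> ` a i \<inter> \<pi> ` a j \<noteq> {}" using F by (auto simp: pairwise_intersecting_def)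
    then have "a i \<inter> a j \<noteq> {}" using permutes_inj[OF p] by (auto simp: inj_eq)
    then obtain x y where xy: "x \<in> cyclic_arc n r i" "y \<in> cyclic_arc n r j" "h x = h y"
      by (auto simp: a_def)
    moreover have "x \<in> ?Z" "y \<in> ?Z" using xy cyclic_arc_subset[OF rn(2)] by blast+
    ultimately have "x = y" using h by (auto simp: bij_betw_def inj_on_def)
    with xy show "cyclic_arc n r i \<inter> cyclic_arc n r j \<noteq> {}" by auto
  qed (use r n_def in auto)
  have "card {\<pi>\<in>?P. \<pi> ` a i \<in> F} * (n choose r) = card F * fact n" for i
  proof -
    have "{\<pi>\<in>?P. \<pi> ` a i \<in> F} = (\<Union>B\<in>F. {\<pi>. \<pi> permutes X \<and> \<pi> ` a i = B})" by auto
    also have "card \<dots> = (\<Sum>B\<in>F. card {\<pi>. \<pi> permutes X \<and> \<pi> ` a i = B})"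
      by (rule card_UN_disjoint) (use finF finite_subset[OF _ finP] in auto)
    finally have "card {\<pi>\<in>?P. \<pi> ` a i \<in> F} * (n choose r) =
        (\<Sum>B\<in>F. card {\<pi>. \<pi> permutes X \<and> \<pi> ` a i = B} * (n choose r))"
      by (simp add: sum_distrib_right)
    also have "\<dots> = (\<Sum>B\<in>F. fact n)"
      by (rule sum.cong[OF refl])
        (use card_permutations_image_eq[OF X a(1)] F a in \<open>auto simp: n_def\<close>)
    finally show ?thesis by simp
  qed
  then have "n * (card F * fact n) = (\<Sum>i\<in>?Z. card {\<pi>\<in>?P. \<pi> ` a i \<in> F}) * (n choose r)"
    by (simp add: sum_distrib_right)
  also have "(\<Sum>i\<in>?Z. card {\<pi>\<in>?P. \<pi> ` a i \<in> F}) = (\<Sum>\<pi>\<in>?P. card {i\<in>?Z. \<pi> ` a i \<in> F})"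
    by (rule sum_multicount_gen) (use finP in auto)
  also have "\<dots> \<le> (\<Sum>\<pi>\<in>?P. r)" by (rule sum_mono) (use arcs in auto)
  also have "\<dots> = fact n * r" using card_permutations[OF refl X] by (simp add: n_def)
  finally have "fact n * (n * card F) \<le> fact n * (r * (n choose r))"
    by (simp add: algebra_simps)
  then have "n * card F \<le> n * ((n - 1) choose (r - 1))"
    using times_binomial_minus1_eq[OF r(1), of n] by simp
  then show ?thesis using rn by (simp add: n_def)
qed

section \<open>Self-annihilating subspaces\<close>

theorem theorem2p3:
  fixes W :: "'n::{finite,linorder} exterior set"
  assumes "subspace W" and "self_annihilating W"
  shows "dim W \<le> 2 ^ (CARD('n) - 1) \<and>
    (\<forall>r. 2 * r \<le> CARD('n) \<longrightarrow> W \<subseteq> ext_power r \<longrightarrow>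
      dim W \<le> (if r = 0 then 0 else (CARD('n) - 1) choose (r - 1)))"
proof (intro conjI allI impI)
  let ?L = "leading_indices set_weight W"
  have dim: "dim W \<le> card ?L" by (rule dim_le_card_leading_indices[OF assms(1)])
  have int: "pairwise_intersecting ?L" by (rule pairwise_intersecting_leading_indices[OF assms(2)])
  show "dim W \<le> 2 ^ (CARD('n) - 1)"
    using dim card_pairwise_intersecting_le[OF int] by linarith
  fix r assume r: "2 * r \<le> CARD('n)" and W: "W \<subseteq> ext_power r"
  have L: "card S = r" if "S \<in> ?L" for S
    using that W by (auto simp: leading_indices_def subset_iff ext_power_iff)
  have "card ?L \<le> (if r = 0 then 0 else (CARD('n) - 1) choose (r - 1))"
  proof (cases "r = 0")
    case True
    \<comment> \<open>The only candidate is the empty set, which does not meet itself.\<close>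
    then have "S \<notin> ?L" for S
      using L[of S] int by (auto simp: pairwise_intersecting_def)
    then have "?L = {}" by blast
    then show ?thesis by simp
  next
    case False
    then show ?thesis using erdos_ko_rado[of UNIV ?L r] L int r by auto
  qed
  with dim show "dim W \<le> (if r = 0 then 0 else (CARD('n) - 1) choose (r - 1))" by linarith
qed

end
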